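(* Let $a,b\ge 1$ be integers and let $$F=\sum_{n\ge 0}\Big(\sum_{\pi\in NC_n}p^{\mu_{1^a}(\pi)}q^{\mu_{1^b2}(\pi)}\Big)x^n$$ be the generating function enumerating the members of $NC_n$ for $n\ge 0$ jointly according to the number of occurrences of the subwords $1^a$ and $1^b2$ (marked by $p$ and $q$, respectively). If $a\ge b\ge 1$, then $F$ satisfies $$\big(x-px^2+q(p-1)x^a+(q-1)(1-px)x^b\big)F^2=\big(1-px+q(p-1)x^a+(q-1)(1-px)x^b\big)F-1+px-(p-1)x^a.$$ If $1\le a<b$, then $F$ satisfies $$\big(x-px^2+(p-1)x^a+(q-1)(1-x)p^{b-a+1}x^b\big)F^2=\big(1-px+(p-1)x^a+(q-1)(1-x)p^{b-a+1}x^b\big)F-1+px-(p-1)x^a.$$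
   Context: A set partition of $[n]=\{1,\dots,n\}$ with blocks $B_1,\dots,B_k$ ordered so that $\min B_1<\cdots<\min B_k$ is represented by its canonical sequential form $\pi=\pi_1\cdots\pi_n$, where $i\in B_{\pi_i}$ for each $i$. It is non-crossing if $\pi$ contains no (not necessarily consecutive) subsequence of the form $a\,b\,a\,b$ with $a<b$. $NC_n$ denotes the set of non-crossing partitions of $[n]$, identified with their canonical sequential forms ($NC_0$ consists of the empty partition). A subword pattern is a finite sequence $\tau=\tau_1\cdots\tau_k$ of positive integers whose set of distinct letters is $[\ell]$ for some $\ell$. An occurrence of $\tau$ in a sequence $\rho_1\cdots\rho_n$ is an index $i\in[n-k+1]$ such that the string of consecutive letters $\rho_i\rho_{i+1}\cdots\rho_{i+k-1}$ is order-isomorphic to $\tau$ (same relative order, including equalities). $\mu_\tau(\pi)$ denotes the number of occurrences of $\tau$ in $\pi$. Exponents denote repetition of letters: $1^a$ is the word of $a$ ones, and $1^b2$ is $b$ ones followed by a $2$. $F$ is regarded as a formal power series in $x$ with coefficients in $\mathbb{Z}[p,q]$. *)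

theory Defs
  imports
    Main
    "HOL-Library.Disjoint_Sets"
    "HOL-Library.Sublist"
    "HOL-Computational_Algebra.Polynomial"
    "HOL-Computational_Algebra.Formal_Power_Series"
begin

definition block_of :: "nat set set \<Rightarrow> nat \<Rightarrow> nat set" where
  "block_of P i = (THE B. B \<in> P \<and> i \<in> B)"

text \<open>The (1-based) position of the block \<open>B\<close> when the blocks of \<open>P\<close> are listed by increasing minimum.\<close>

definition block_index :: "nat set set \<Rightarrow> nat set \<Rightarrow> nat" where
  "block_index P B = card {C \<in> P. Min C \<le> Min B}"

definition canonical_form :: "nat \<Rightarrow> nat set set \<Rightarrow> nat list" where
  "canonical_form n P = map (\<lambda>i. block_index P (block_of P i)) [1..<Suc n]"

definition noncrossing :: "nat list \<Rightarrow> bool" where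
  "noncrossing w \<longleftrightarrow> \<not> (\<exists>a b. a < b \<and> subseq [a, b, a, b] w)"

definition NC :: "nat \<Rightarrow> nat list set" where
  "NC n = {canonical_form n P | P. partition_on {1..n} P \<and> noncrossing (canonical_form n P)}"

definition order_isomorphic :: "nat list \<Rightarrow> nat list \<Rightarrow> bool" where
  "order_isomorphic u v \<longleftrightarrow> length u = length v \<and>
     (\<forall>i<length u. \<forall>j<length u.
        (u ! i < u ! j \<longleftrightarrow> v ! i < v ! j) \<and> (u ! i = u ! j \<longleftrightarrow> v ! i = v ! j))"

text \<open>Occurrences are counted by their 0-based starting positions.\<close>

definition occurrences :: "nat list \<Rightarrow> nat list \<Rightarrow> nat" where
  "occurrences \<tau> w =
     card {i. i + length \<tau> \<le> length w \<and> order_isomorphic (take (length \<tau>) (drop i w)) \<tau>}"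

text \<open>The ring \<open>\<int>[p,q]\<close> is represented as \<open>\<int>[p][q]\<close>, i.e. by the type \<^typ>\<open>int poly poly\<close>:
  the outer variable is \<open>q\<close>, the inner one is \<open>p\<close>.\<close>

definition var_p :: "int poly poly" where
  "var_p = [:[:0, 1:]:]"

definition var_q :: "int poly poly" where
  "var_q = [:0, 1:]"

definition NC_gf :: "nat \<Rightarrow> nat \<Rightarrow> int poly poly fps" where
  "NC_gf a b = Abs_fps (\<lambda>n. \<Sum>\<pi>\<in>NC n.
     var_p ^ occurrences (replicate a 1) \<pi> * var_q ^ occurrences (replicate b 1 @ [2]) \<pi>)"

end

theory Submission
  imports Defs
begin

text \<open>A non-empty non-crossing canonical word is either \<open>1\<^sup>j\<close> or factors uniquely as
  \<open>1\<^sup>j \<alpha>' \<rho>'\<close>, where \<open>\<alpha>'\<close> is non-empty without ones and \<open>\<rho>'\<close> is empty or starts with \<open>1\<close>.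
  After renaming letters, \<open>\<alpha>'\<close> and \<open>\<rho>'\<close> are arbitrary non-crossing canonical words.
  The letters strictly rise from \<open>1\<^sup>j\<close> to \<open>\<alpha>'\<close> and strictly fall from \<open>\<alpha>'\<close> to \<open>\<rho>'\<close>, so the only
  occurrence of one of the two patterns straddling a boundary is one copy of \<open>1\<^sup>b2\<close>, present when \<open>b \<le> j\<close>.
  With the series \<open>A\<close> and \<open>B\<close> of runs \<open>1\<^sup>j\<close>, \<open>B\<close> also counting that copy, this gives
  \<open>F = 1 + A + B (F - 1) F\<close>, and multiplying by \<open>(1 - x)(1 - px)\<close> clears the denominators of \<open>A\<close> and \<open>B\<close>.\<close>

section \<open>Canonical forms as restricted growth words\<close>

text \<open>Restricted growth words, encoded through all splittings at a letter so that the prefix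
  before it is at hand as a list.\<close>

definition rgf :: "nat list \<Rightarrow> bool" where
  "rgf w \<longleftrightarrow> (\<forall>u c v. w = u @ c # v \<longrightarrow> 0 < c \<and> {1..<c} \<subseteq> set u)"

lemma rgfI: "(\<And>u c v. w = u @ c # v \<Longrightarrow> 0 < c \<and> {1..<c} \<subseteq> set u) \<Longrightarrow> rgf w"
  by (simp add: rgf_def)

lemma rgfD:
  assumes "rgf w" "w = u @ c # v"
  shows "0 < c" "\<And>d. 0 < d \<Longrightarrow> d < c \<Longrightarrow> d \<in> set u"
  using assms by (auto simp: rgf_def subset_iff)

lemma rgf_pos: "rgf w \<Longrightarrow> c \<in> set w \<Longrightarrow> 0 < c"
  by (metis rgfD(1) split_list)

lemma rgf_downward:
  assumes "rgf w" "c \<in> set w" "0 < d" "d \<le> c"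
  shows "d \<in> set w"
proof (cases "d = c")
  case False
  obtain u v where w: "w = u @ c # v"
    using assms(2) by (meson split_list)
  have "d \<in> set u"
    using rgfD(2)[OF assms(1) w] assms(3,4) False by simp
  then show ?thesis
    using w by simp
qed (use assms in simp)

text \<open>Makes \<open>card (set w)\<close> the number of blocks and, for non-empty words, the
  largest letter, hence the right shift in \<open>comb\<close>.\<close>

lemma rgf_set:
  assumes "rgf w"
  shows "set w = {1..card (set w)}"
proof (cases "w = []")
  case False
  let ?m = "Max (set w)"
  have "set w = {1..?m}"
  proof (intro set_eqI iffI)
    fix c assume "c \<in> {1..?m}"
    then show "c \<in> set w"
      using rgf_downward[OF assms, of ?m c] False by auto
  qed (use rgf_pos[OF assms] in \<open>auto simp: Suc_le_eq\<close>)
  then show ?thesis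
    by (metis card_atLeastAtMost diff_Suc_1)
qed auto

lemma rgf_Cons: "rgf (c # w) \<Longrightarrow> c = 1"
  using rgfD(1)[of "c # w" "[]" c w] rgfD(2)[of "c # w" "[]" c w 1] by force

section \<open>Correspondence between set partitions and restricted growth words\<close>

lemma block_of_eq:
  assumes "partition_on A P" "B \<in> P" "i \<in> B"
  shows "block_of P i = B"
  unfolding block_of_def
  using assms by (intro the_equality) (auto dest: partition_onD2 disjointD)

text \<open>A block of smaller index has a smaller minimum. This minimum lies strictly before the
  current position, so its index has already been written.\<close>

lemma rgf_canonical_form:
  assumes P: "partition_on {1..n} P"
  shows "rgf (canonical_form n P)"
proof -
  let ?I = "block_index P"
  have finP: "finite P"
    using finite_elements[OF _ P] by simp
  have fin: "finite B" if "B \<in> P" for B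
    using that P by (metis Sup_upper finite_atLeastAtMost finite_subset partition_onD1)
  have ne: "B \<noteq> {}" if "B \<in> P" for B
    using that P by (auto simp: partition_on_def)
  have mem: "Min B \<in> B" if "B \<in> P" for B
    using that fin ne by simp
  have le: "?I C \<le> ?I B" if "Min C \<le> Min B" for B C
    unfolding block_index_def using finP that by (intro card_mono) auto
  have less: "?I C < ?I B" if "Min C < Min B" "B \<in> P" for B C
    unfolding block_index_def
  proof (rule psubset_card_mono)
    show "{D \<in> P. Min D \<le> Min C} \<subset> {C \<in> P. Min C \<le> Min B}"
      using that by (intro psubsetI) (auto dest!: equalityD2 intro!: bexI[of _ B] simp: subset_iff not_le)
  qed (use finP in simp)
  have inj: "inj_on ?I P"
  proof (rule inj_onI)
    fix B C assume BC: "B \<in> P" "C \<in> P" "?I B = ?I C"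
    then have "Min B = Min C"
      using less[of B C] less[of C B] by force
    then show "B = C"
      using BC mem P by (metis block_of_eq)
  qed
  \<comment> \<open>By injectivity the image is as large as \<open>{1..card P}\<close>, which
    contains it, so every smaller index belongs to some block.\<close>
  have surj: "?I ` P = {1..card P}"
  proof (rule card_subset_eq)
    have "0 < ?I B" if "B \<in> P" for B
      unfolding block_index_def using that finP by (auto simp: card_gt_0_iff)
    moreover have "?I B \<le> card P" for B
      unfolding block_index_def using finP by (intro card_mono) auto
    ultimately show "?I ` P \<subseteq> {1..card P}"
      by (auto simp: Suc_le_eq)
  qed (auto simp: card_image[OF inj])
  show ?thesis
  proof (rule rgfI)
    fix u c v assume w: "canonical_form n P = u @ c # v"
    let ?i = "Suc (length u)"
    have len: "length (canonical_form n P) = n"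
      by (simp add: canonical_form_def del: upt_Suc)
    then have ltn: "length u < n"
      using w by (metis length_append length_Cons less_add_Suc1 add_Suc_right)
    have nth: "canonical_form n P ! k = ?I (block_of P (Suc k))" if "k < n" for k
      using that by (simp add: canonical_form_def del: upt_Suc)
    have "?i \<in> \<Union>P"
      using P ltn by (auto simp: partition_on_def)
    then obtain B where B: "B \<in> P" "?i \<in> B"
      by blast
    have c: "c = ?I B"
      using nth[OF ltn] w block_of_eq[OF P B] by simp
    have c_in: "c \<in> {1..card P}"
      using surj B c by blast
    have "d \<in> set u" if d: "1 \<le> d" "d < c" for d
    proof -
      have "d \<in> ?I ` P"
        using surj d c_in by auto
      then obtain C where C: "C \<in> P" "d = ?I C"
        by blast
      have "Min C < Min B"
        using d le[of B C] C c by force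
      moreover have "Min B \<le> ?i"
        using B fin by simp
      ultimately have lt: "Min C < ?i" by simp
      have "Min C \<in> {1..n}"
        using mem[OF C(1)] C(1) P by (auto simp: partition_on_def)
      then obtain m where m: "Min C = Suc m"
        by (cases "Min C") auto
      have "u ! m = d"
        using nth[of m] w lt m ltn block_of_eq[OF P C(1) mem[OF C(1)]] C(2)
        by (simp add: nth_append)
      then show ?thesis
        using lt m by (auto simp: in_set_conv_nth)
    qed
    then show "0 < c \<and> {1..<c} \<subseteq> set u"
      using c_in by auto
  qed
qed

text \<open>The level sets of \<open>w\<close> serve as blocks. Restricted growth makes first
  occurrences follow the order of the letters, so ranking blocks by minimum returns the
  letters.\<close>

lemma canonical_form_surj:
  assumes w: "rgf w"
  shows "\<exists>P. partition_on {1..length w} P \<and> canonical_form (length w) P = w"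
proof -
  let ?n = "length w"
  \<comment> \<open>Elements of the partition are 1-based, list positions 0-based; hence
    \<open>i - 1\<close>.\<close>
  define B where "B c = {i \<in> {1..?n}. w ! (i - 1) = c}" for c
  have fin: "finite (B c)" for c
    by (simp add: B_def)
  have mem: "i \<in> B (w ! (i - 1))" "w ! (i - 1) \<in> set w" if "i \<in> {1..?n}" for i
    using that by (auto simp: B_def)
  have ne: "B c \<noteq> {}" if c: "c \<in> set w" for c
  proof -
    obtain k where "k < ?n" "w ! k = c"
      using c by (auto simp: in_set_conv_nth)
    then have "Suc k \<in> B c"
      by (auto simp: B_def)
    then show ?thesis by blast
  qed
  have disj: "c = d" if "i \<in> B c" "i \<in> B d" for i c d
    using that by (simp add: B_def)
  define P where "P = B ` set w"
  have P: "partition_on {1..?n} P"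
  proof (rule partition_onI)
    show "\<Union>P = {1..?n}"
      using mem by (auto simp: P_def) (auto simp: B_def)
    show "disjnt p q" if "p \<in> P" "q \<in> P" "p \<noteq> q" for p q
      using that disj by (auto simp: P_def disjnt_def)
    show "{} \<notin> P"
      using ne by (auto simp: P_def)
  qed
  have Min_less: "Min (B c) < Min (B d)" if cd: "c < d" "c \<in> set w" "d \<in> set w" for c d
  proof -
    have "Min (B d) \<in> B d"
      using fin ne cd by simp
    then obtain i where i: "Min (B d) = Suc i" "i < ?n" "w ! i = d"
      by (cases "Min (B d)") (auto simp: B_def)
    have "w = take i w @ d # drop (Suc i) w"
      using i by (metis id_take_nth_drop)
    then have "c \<in> set (take i w)"
      using rgfD(2)[OF w] cd rgf_pos[OF w] by blast
    then obtain k where k: "k < i" "w ! k = c"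
      using i(2) unfolding in_set_conv_nth by auto
    then have "Suc k \<in> B c"
      using i by (auto simp: B_def)
    then have "Min (B c) \<le> Suc k"
      using fin by simp
    then show ?thesis
      using i k by simp
  qed
  have Min_le: "Min (B c) \<le> Min (B d) \<longleftrightarrow> c \<le> d" if "c \<in> set w" "d \<in> set w" for c d
    using Min_less[of c d] Min_less[of d c] that by (cases c d rule: linorder_cases) auto
  have inj: "inj_on B (set w)"
    using ne disj by (metis ex_in_conv inj_onI)
  \<comment> \<open>Exactly \<open>B 1\<close>, ..., \<open>B c\<close> have a minimum up to that of
    \<open>B c\<close>, since the set of letters is closed downwards.\<close>
  have index: "block_index P (B c) = c" if c: "c \<in> set w" for c
  proof -
    have "{C \<in> P. Min C \<le> Min (B c)} = B ` {d \<in> set w. d \<le> c}"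
      using Min_le c by (auto simp: P_def)
    moreover have "card (B ` {d \<in> set w. d \<le> c}) = card {d \<in> set w. d \<le> c}"
      by (rule card_image, rule inj_on_subset[OF inj]) auto
    moreover have "{d \<in> set w. d \<le> c} = {1..c}"
      using c rgf_pos[OF w] rgf_downward[OF w c] by (auto simp: Suc_le_eq)
    ultimately show ?thesis
      by (simp add: block_index_def)
  qed
  have "canonical_form ?n P = w"
  proof (rule nth_equalityI)
    fix i assume "i < length (canonical_form ?n P)"
    then have i: "i < ?n"
      by (simp add: canonical_form_def del: upt_Suc)
    then have "block_of P (Suc i) = B (w ! i)"
      using mem[of "Suc i"] by (intro block_of_eq[OF P]) (auto simp: P_def)
    then show "canonical_form ?n P ! i = w ! i"
      using i index by (simp add: canonical_form_def del: upt_Suc)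
  qed (simp add: canonical_form_def del: upt_Suc)
  with P show ?thesis by blast
qed

text \<open>All lengths are pooled, so that length can act as the size function of a weighted
  class.\<close>

definition ncw :: "nat list set" where
  "ncw = {w. rgf w \<and> noncrossing w}"

lemma NC_eq: "NC n = {w \<in> ncw. length w = n}"
proof (intro set_eqI iffI)
  fix w assume "w \<in> NC n"
  then obtain P where "w = canonical_form n P" "partition_on {1..n} P" "noncrossing w"
    by (auto simp: NC_def)
  moreover have "length (canonical_form n P) = n"
    by (simp add: canonical_form_def del: upt_Suc)
  ultimately show "w \<in> {w \<in> ncw. length w = n}"
    using rgf_canonical_form by (simp add: ncw_def)
next
  fix w assume "w \<in> {w \<in> ncw. length w = n}"
  then show "w \<in> NC n"
    using canonical_form_surj[of w] unfolding NC_def ncw_def by force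
qed

lemma ncw_finite: "finite {w \<in> ncw. length w = n}"
proof (rule finite_subset)
  show "{w \<in> ncw. length w = n} \<subseteq> {w. set w \<subseteq> {..n} \<and> length w = n}"
  proof
    fix w assume "w \<in> {w \<in> ncw. length w = n}"
    then have w: "rgf w" "length w = n"
      by (simp_all add: ncw_def)
    have "c \<le> n" if "c \<in> set w" for c
      using that rgf_set[OF w(1)] card_length[of w] w(2) by (metis atLeastAtMost_iff le_trans)
    with w show "w \<in> {w. set w \<subseteq> {..n} \<and> length w = n}"
      by auto
  qed
qed (simp add: finite_lists_length_eq)

section \<open>Decomposition after the initial run of ones\<close>

text \<open>The value 0 never occurs in a restricted growth word; fixing it too keeps the renaming
  strictly monotone on all of \<open>nat\<close>.\<close>

definition lift :: "nat \<Rightarrow> nat \<Rightarrow> nat" where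
  "lift k c = (if c \<le> 1 then c else c + k)"

text \<open>Here \<open>\<alpha>\<close> is the stretch between the initial run of ones and the next one, and
  \<open>\<rho>\<close> is what follows; non-crossing means that the two share no letters. The ones of \<open>\<rho>\<close>
  belong to the block of the initial run, which is why \<^const>\<open>lift\<close> fixes them.\<close>

definition comb :: "nat \<Rightarrow> nat list \<Rightarrow> nat list \<Rightarrow> nat list" where
  "comb j \<alpha> \<rho> = replicate j 1 @ map Suc \<alpha> @ map (lift (card (set \<alpha>))) \<rho>"

lemma length_comb: "length (comb j \<alpha> \<rho>) = j + (length \<alpha> + length \<rho>)"
  by (simp add: comb_def)

lemma strict_mono_lift: "strict_mono (lift k)"
  by (rule strict_monoI) (auto simp: lift_def)

lemma strict_mono_Suc: "strict_mono Suc"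
  by (rule strict_monoI) simp

lemma lift_eq_1: "lift k c = 1 \<longleftrightarrow> c = 1"
  by (auto simp: lift_def)

lemma subseq_set: "subseq u w \<Longrightarrow> set u \<subseteq> set w"
  by (auto elim: list_emb_set)

section \<open>Non-crossing words under monotone renaming\<close>

lemma subseq_map_injD:
  assumes "inj f" "subseq (map f u) (map f w)"
  shows "subseq u w"
  using subseq_map[OF assms(2), of "inv f"] assms(1) by (simp add: o_def)

lemma noncrossing_map:
  assumes f: "strict_mono f" and nc: "noncrossing (map f w)"
  shows "noncrossing w"
  unfolding noncrossing_def
proof clarify
  fix a b assume "a < b" "subseq [a, b, a, b] w"
  then have "f a < f b" "subseq [f a, f b, f a, f b] (map f w)"
    using f subseq_map[of "[a, b, a, b]" w f] by (auto simp: strict_mono_less)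
  with nc show False
    unfolding noncrossing_def by blast
qed

lemma noncrossing_subseq: "noncrossing w \<Longrightarrow> subseq u w \<Longrightarrow> noncrossing u"
  unfolding noncrossing_def by (meson subseq_order.order_trans)

lemma noncrossing_map_no_abab:
  assumes f: "strict_mono (f :: nat \<Rightarrow> nat)" and nc: "noncrossing w"
    and sub: "subseq [a, b, a, b] (map f w)" and "a < b"
  shows False
proof -
  have "a \<in> set (map f w)" "b \<in> set (map f w)"
    using subseq_set[OF sub] by auto
  then obtain c d where cd: "a = f c" "b = f d" by auto
  have "subseq (map f [c, d, c, d]) (map f w)"
    using sub cd by simp
  then have "subseq [c, d, c, d] w"
    using subseq_map_injD[OF strict_mono_imp_inj_on[OF f]] by blast
  moreover have "c < d"
    using \<open>a < b\<close> cd f by (simp add: strict_mono_less)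
  ultimately show False
    using nc unfolding noncrossing_def by blast
qed

text \<open>The factors use the letters \<open>{1}\<close>, \<open>{2..Suc k}\<close>, and 1
  together with letters above \<open>Suc k\<close>, so every new letter comes in its turn. A
  crossing would lie inside one factor, or take only its first letter from the initial run; in the
  latter case \<open>\<rho>\<close> already contains it.\<close>

lemma comb_in_ncw:
  assumes \<alpha>: "\<alpha> \<in> ncw" and \<rho>: "\<rho> \<in> ncw" and j: "0 < j"
  shows "comb j \<alpha> \<rho> \<in> ncw"
proof -
  define k where "k = card (set \<alpha>)"
  have ra: "rgf \<alpha>" and rr: "rgf \<rho>" and na: "noncrossing \<alpha>" and nr: "noncrossing \<rho>"
    using \<alpha> \<rho> by (auto simp: ncw_def)
  have sa: "set \<alpha> = {1..k}"
    using rgf_set[OF ra] by (simp add: k_def)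
  have sa': "set (map Suc \<alpha>) = {2..Suc k}"
    by (simp only: set_map sa image_Suc_atLeastAtMost) simp
  have sr: "c = 1 \<or> Suc k < c" if c: "c \<in> set (map (lift k) \<rho>)" for c
  proof -
    obtain d where "d \<in> set \<rho>" "c = lift k d" using c by auto
    then show ?thesis using rgf_pos[OF rr, of d] by (auto simp: lift_def)
  qed
  have w: "comb j \<alpha> \<rho> = replicate j 1 @ map Suc \<alpha> @ map (lift k) \<rho>"
    by (simp add: comb_def k_def)
  have "rgf (comb j \<alpha> \<rho>)"
  proof (rule rgfI)
    fix u c v assume *: "comb j \<alpha> \<rho> = u @ c # v"
    \<comment> \<open>The three cases record which factor contains the inspected letter
      \<open>c\<close>.\<close>
    then consider
        v' where "replicate j 1 = u @ c # v'"
      | u' v' where "u = replicate j 1 @ u'" "map Suc \<alpha> = u' @ c # v'"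
      | u' where "u = replicate j 1 @ map Suc \<alpha> @ u'" "map (lift k) \<rho> = u' @ c # v"
      unfolding w by (auto simp: append_eq_append_conv2 append_eq_Cons_conv Cons_eq_append_conv)
    then show "0 < c \<and> {1..<c} \<subseteq> set u"
    proof cases
      case 1
      then have "c \<in> set (replicate j (1::nat))" by simp
      then show ?thesis by simp
    next
      case 2
      then obtain u0 d v0 where d: "\<alpha> = u0 @ d # v0" "u' = map Suc u0" "c = Suc d"
        by (auto simp: map_eq_append_conv)
      have "e \<in> set u" if "1 \<le> e" "e < c" for e
      proof (cases "e = 1")
        case True then show ?thesis using 2 j by simp
      next
        case False
        then have "e - 1 \<in> set u0"
          using rgfD(2)[OF ra d(1), of "e - 1"] that d by auto
        then have "Suc (e - 1) \<in> set u"
          using 2 d by simp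
        then show ?thesis using that by simp
      qed
      then show ?thesis using d by auto
    next
      case 3
      then obtain u0 d v0 where d: "\<rho> = u0 @ d # v0" "u' = map (lift k) u0" "c = lift k d"
        by (auto simp: map_eq_append_conv)
      have dpos: "0 < d"
        using rgfD(1)[OF rr d(1)] .
      have "e \<in> set u" if "1 \<le> e" "e < c" for e
      proof -
        consider "e = 1" | "2 \<le> e" "e \<le> Suc k" | "Suc k < e"
          by atomize_elim (use \<open>1 \<le> e\<close> in arith)
        then show ?thesis
        proof cases
          case 1 then show ?thesis using 3 j by simp
        next
          case 2 then show ?thesis using 3 sa' by simp
        next
          case e: 3
          \<comment> \<open>Here \<open>e\<close> lies beyond the letters of
            \<open>\<alpha>\<close>, so it can only be the lift of \<open>e - k\<close>, which
            restricted growth of \<open>\<rho>\<close> places before \<open>d\<close>.\<close>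
          have "e - k \<in> set u0"
            using e that d dpos by (intro rgfD(2)[OF rr d(1)]) (auto simp: lift_def split: if_splits)
          moreover have "e = lift k (e - k)"
            using e by (simp add: lift_def)
          ultimately have "e \<in> set u'"
            using d by (metis image_eqI set_map)
          then show ?thesis using 3 by simp
        qed
      qed
      then show ?thesis using d dpos by (auto simp: lift_def)
    qed
  qed
  moreover have "noncrossing (comb j \<alpha> \<rho>)"
    unfolding noncrossing_def
  proof clarify
    fix a b :: nat assume ab: "a < b" "subseq [a, b, a, b] (comb j \<alpha> \<rho>)"
    \<comment> \<open>The embedded word splits along the three factors. Their letter ranges meet
      only in 1, which leaves few possible splittings.\<close>
    obtain s1 s2 s3 where s: "[a, b, a, b] = s1 @ s2 @ s3"
      "subseq s1 (replicate j 1)" "subseq s2 (map Suc \<alpha>)" "subseq s3 (map (lift k) \<rho>)"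
      using ab(2) unfolding w by (metis subseq_appendE)
    have m1: "set s1 \<subseteq> {1}"
      using subseq_set[OF s(2)] by auto
    have m2: "set s2 \<subseteq> {2..Suc k}"
      using subseq_set[OF s(3)] sa' by simp
    have m3: "set s3 \<subseteq> {1} \<union> {Suc k<..}"
      using subseq_set[OF s(4)] sr by auto
    have pos: "0 < a"
      using s(1) m1 m2 m3 by (auto simp: Cons_eq_append_conv)
    have no: False if "s3 = [a, b, a, b]"
      using noncrossing_map_no_abab[OF strict_mono_lift nr _ ab(1)] s(4) that by blast
    \<comment> \<open>The leading 1 of \<open>\<rho>\<close> can replace the 1 taken from the
      initial run: since \<open>b\<close> exceeds 1, the word \<open>b a b\<close> is embedded after
      that leading 1.\<close>
    have no': False if s3: "s3 = [b, a, b]" "a = 1"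
    proof -
      obtain \<rho>1 where \<rho>1: "\<rho> = 1 # \<rho>1"
        using s(4) s3(1) rgf_Cons rr by (cases \<rho>) auto
      have "subseq [b, a, b] (map (lift k) \<rho>1)"
        using s(4) that ab(1) \<rho>1 by (simp add: lift_def)
      then have "subseq [a, b, a, b] (map (lift k) \<rho>)"
        using \<rho>1 that by (simp add: lift_def)
      then show False
        using noncrossing_map_no_abab[OF strict_mono_lift nr _ ab(1)] by blast
    qed
    have no2: False if "s2 = [a, b, a, b]"
      using noncrossing_map_no_abab[OF strict_mono_Suc na _ ab(1)] s(3) that by blast
    show False
      using s(1) m1 m2 m3 no no' no2 ab(1) pos by (auto simp: Cons_eq_append_conv)
  qed
  ultimately show ?thesis by (simp add: ncw_def)
qed

lemma replicate_in_ncw: "replicate j 1 \<in> ncw"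
proof -
  have "rgf (replicate j 1)"
  proof (rule rgfI)
    fix u c v assume "replicate j (1::nat) = u @ c # v"
    then have "c \<in> set (replicate j (1::nat))" by simp
    then show "0 < c \<and> {1..<c} \<subseteq> set u" by simp
  qed
  moreover have "noncrossing (replicate j 1)"
    unfolding noncrossing_def
  proof clarify
    fix a b :: nat assume "a < b" "subseq [a, b, a, b] (replicate j 1)"
    then show False
      using subseq_set[of "[a, b, a, b]" "replicate j 1"] by auto
  qed
  ultimately show ?thesis by (simp add: ncw_def)
qed

text \<open>The word is cut at the first letter other than 1 and again at the next 1. Avoiding
  crossings separates the letters of the two remaining factors, so both renamings can be
  undone.\<close>

lemma ncw_cases:
  assumes w: "w \<in> ncw" and ne: "w \<noteq> []"
  shows "(\<exists>j>0. w = replicate j 1) \<or> (\<exists>j>0. \<exists>\<alpha>\<in>ncw - {[]}. \<exists>\<rho>\<in>ncw. w = comb j \<alpha> \<rho>)"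
proof -
  have rw: "rgf w" and nw: "noncrossing w"
    using w by (auto simp: ncw_def)
  define u where "u = takeWhile (\<lambda>c. c = 1) w"
  define v where "v = dropWhile (\<lambda>c. c = 1) w"
  define \<alpha>' where "\<alpha>' = takeWhile (\<lambda>c. c \<noteq> 1) v"
  define \<rho>' where "\<rho>' = dropWhile (\<lambda>c. c \<noteq> 1) v"
  have wuv: "w = u @ \<alpha>' @ \<rho>'"
    by (simp add: u_def v_def \<alpha>'_def \<rho>'_def)
  define j where "j = length u"
  have u: "u = replicate j 1"
    unfolding j_def by (rule replicate_eqI[OF refl]) (auto simp: u_def dest: set_takeWhileD)
  have j: "0 < j"
    using ne rw rgf_Cons by (cases w) (auto simp: j_def u_def)
  have \<alpha>1: "1 < c" if "c \<in> set \<alpha>'" for c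
  proof -
    have "c \<noteq> 1" using that unfolding \<alpha>'_def by (auto dest: set_takeWhileD)
    moreover have "0 < c" using that rgf_pos[OF rw] wuv by simp
    ultimately show ?thesis by simp
  qed
  have \<rho>hd: "\<rho>' = [] \<or> hd \<rho>' = 1"
    unfolding \<rho>'_def using hd_dropWhile by blast
  show ?thesis
  proof (cases "\<alpha>' = []")
    case True
    have "v = []"
    proof (rule ccontr)
      assume v: "v \<noteq> []"
      then have "hd v \<noteq> 1"
        unfolding v_def by (rule hd_dropWhile)
      with v True show False
        by (cases v) (auto simp: \<alpha>'_def)
    qed
    then have "w = replicate j 1"
      using wuv u by (simp add: \<alpha>'_def \<rho>'_def)
    with j show ?thesis by blast
  next
    case False
    define \<alpha> where "\<alpha> = map (\<lambda>c. c - 1) \<alpha>'"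
    have \<alpha>': "\<alpha>' = map Suc \<alpha>"
      unfolding \<alpha>_def map_map by (rule map_idI[symmetric]) (auto dest!: \<alpha>1)
    have ra: "rgf \<alpha>"
    proof (rule rgfI)
      fix x c y assume *: "\<alpha> = x @ c # y"
      have eq: "w = (replicate j 1 @ map Suc x) @ Suc c # (map Suc y @ \<rho>')"
        using wuv u \<alpha>' * by simp
      have "0 < c" using \<alpha>1[of "Suc c"] \<alpha>' * by simp
      moreover have "d \<in> set x" if "1 \<le> d" "d < c" for d
        using rgfD(2)[OF rw eq, of "Suc d"] that by auto
      ultimately show "0 < c \<and> {1..<c} \<subseteq> set x" by auto
    qed
    have "subseq \<alpha>' w"
      using wuv by (metis list_emb_append2 list_emb_append_mono subseq_order.order_refl
          subseq_rev_drop_many subseq_drop_many append.right_neutral)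
    then have na: "noncrossing \<alpha>"
      using noncrossing_subseq[OF nw] noncrossing_map[OF strict_mono_Suc] \<alpha>' by blast
    define k where "k = card (set \<alpha>)"
    have sa: "set \<alpha>' = {2..Suc k}"
      using rgf_set[OF ra] by (simp only: \<alpha>' set_map k_def) (metis image_Suc_atLeastAtMost numeral_2_eq_2 One_nat_def)
    \<comment> \<open>A larger letter \<open>c\<close> shared by both factors would give
      \<open>1 c 1 c\<close>, with one 1 from the initial run and the other at the head of
      \<open>\<rho>'\<close>.\<close>
    have sr: "c = 1 \<or> Suc k < c" if c: "c \<in> set \<rho>'" for c
    proof (rule ccontr)
      assume *: "\<not> (c = 1 \<or> Suc k < c)"
      moreover have "0 < c" using c wuv rgf_pos[OF rw] by simp
      ultimately have c2: "c \<in> set \<alpha>'" "1 < c" using sa by auto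
      obtain \<rho>1 where \<rho>1: "\<rho>' = 1 # \<rho>1" using \<rho>hd c by (cases \<rho>') auto
      have "subseq [1] u" "subseq [c] \<alpha>'" "subseq [c] \<rho>1"
        using c c2 \<rho>1 j u by (auto simp: subseq_singleton_left)
      then have "subseq ([1] @ [c] @ [1, c]) w"
        unfolding wuv \<rho>1 by (intro list_emb_append_mono) auto
      then show False using nw c2 unfolding noncrossing_def by auto
    qed
    define \<rho> where "\<rho> = map (\<lambda>c. if c = 1 then 1 else c - k) \<rho>'"
    have \<rho>': "\<rho>' = map (lift k) \<rho>"
      unfolding \<rho>_def map_map
      by (rule map_idI[symmetric]) (auto simp: lift_def dest!: sr)
    have "subseq \<rho>' w"
      using wuv by (metis subseq_drop_many subseq_order.order_refl)
    then have nr: "noncrossing \<rho>"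
      using noncrossing_subseq[OF nw] noncrossing_map[OF strict_mono_lift] \<rho>' by blast
    have rr: "rgf \<rho>"
    proof (rule rgfI)
      fix x c y assume *: "\<rho> = x @ c # y"
      have eq: "w = (replicate j 1 @ \<alpha>' @ map (lift k) x) @ lift k c # map (lift k) y"
        using wuv u \<rho>' * by simp
      have pos: "0 < c"
        using rgfD(1)[OF rw eq] by (cases c) (auto simp: lift_def)
      moreover have "d \<in> set x" if d: "1 \<le> d" "d < c" for d
      proof (cases "d = 1")
        case True
        have "x \<noteq> []"
        proof
          assume "x = []"
          then have "lift k c = 1" using \<rho>hd \<rho>' * by simp
          then show False using d by (simp add: lift_def split: if_splits)
        qed
        moreover have "hd x = 1"
          using \<rho>hd \<rho>' * \<open>x \<noteq> []\<close> lift_eq_1 by (simp add: hd_map)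
        ultimately show ?thesis using True by (metis hd_in_set)
      next
        case False
        then have dk: "d + k = lift k d" "lift k d < lift k c"
          using d strict_mono_less[OF strict_mono_lift] by (auto simp: lift_def)
        \<comment> \<open>Restricted growth of \<open>w\<close> yields an earlier occurrence; as
          \<open>lift k d\<close> exceeds every letter of the first two factors, it must lie in the
          image of \<open>x\<close>.\<close>
        then have "lift k d \<in> set (replicate j 1 @ \<alpha>' @ map (lift k) x)"
          using rgfD(2)[OF rw eq, of "lift k d"] d by simp
        moreover have "lift k d \<notin> set (replicate j 1 @ \<alpha>')"
          using sa False d by (auto simp: lift_def)
        ultimately have "lift k d \<in> lift k ` set x" by auto
        then show ?thesis
          using inj_image_mem_iff[OF strict_mono_imp_inj_on[OF strict_mono_lift]] by blast
      qed
      ultimately show "0 < c \<and> {1..<c} \<subseteq> set x" by auto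
    qed
    have "w = comb j \<alpha> \<rho>"
      using wuv u \<alpha>' \<rho>' by (simp add: comb_def k_def)
    moreover have "\<alpha> \<noteq> []" using False \<alpha>' by simp
    ultimately show ?thesis
      using j ra na rr nr by (auto simp: ncw_def)
  qed
qed

lemma takeWhile_replicate_append:
  "v = [] \<or> hd v \<noteq> c \<Longrightarrow> takeWhile (\<lambda>x. x = c) (replicate j c @ v) = replicate j c"
  by (cases v) (simp_all add: takeWhile_append)

text \<open>The initial run gives \<open>j\<close>, the stretch up to the next 1 gives
  \<open>\<alpha>\<close>, the rest gives \<open>\<rho>\<close>. An empty \<open>\<alpha>\<close>
  would let the run merge with the leading 1 of \<open>\<rho>\<close>.\<close>

lemma comb_inj:
  assumes \<alpha>: "\<alpha> \<in> ncw" "\<alpha> \<noteq> []" "\<alpha>' \<in> ncw" "\<alpha>' \<noteq> []" and \<rho>: "\<rho> \<in> ncw" "\<rho>' \<in> ncw"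
    and eq: "comb j \<alpha> \<rho> = comb j' \<alpha>' \<rho>'"
  shows "j = j' \<and> \<alpha> = \<alpha>' \<and> \<rho> = \<rho>'"
proof -
  have t1: "length (takeWhile (\<lambda>c. c = 1) (comb i \<beta> \<sigma>)) = i" if "\<beta> \<in> ncw" "\<beta> \<noteq> []" for i \<beta> \<sigma>
  proof -
    have "0 < hd \<beta>" using that rgf_pos hd_in_set by (auto simp: ncw_def)
    then show ?thesis
      unfolding comb_def using that by (subst takeWhile_replicate_append) (auto simp: hd_map)
  qed
  have t2: "takeWhile (\<lambda>c. c \<noteq> 1) (drop i (comb i \<beta> \<sigma>)) = map Suc \<beta>"
    if "\<beta> \<in> ncw" "\<sigma> \<in> ncw" for i \<beta> \<sigma>
  proof -
    have "0 < c" if "c \<in> set \<beta>" for c using \<open>\<beta> \<in> ncw\<close> that rgf_pos by (auto simp: ncw_def)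
    then have "takeWhile (\<lambda>c. c \<noteq> 1) (drop i (comb i \<beta> \<sigma>))
        = map Suc \<beta> @ takeWhile (\<lambda>c. c \<noteq> 1) (map (lift (card (set \<beta>))) \<sigma>)"
      unfolding comb_def by (simp, subst takeWhile_append2) auto
    also have "takeWhile (\<lambda>c. c \<noteq> 1) (map (lift (card (set \<beta>))) \<sigma>) = []"
      using that(2) rgf_Cons by (cases \<sigma>) (auto simp: ncw_def lift_def)
    finally show ?thesis by simp
  qed
  have j: "j = j'"
    using t1 \<alpha> eq by metis
  have a: "\<alpha> = \<alpha>'"
    using t2[of \<alpha> \<rho> j] t2[of \<alpha>' \<rho>' j'] \<alpha> \<rho> eq j by (simp add: inj_map_eq_map)
  have "map (lift (card (set \<alpha>))) \<rho> = map (lift (card (set \<alpha>))) \<rho>'"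
    using eq j a by (simp add: comb_def)
  then have "\<rho> = \<rho>'"
    by (simp add: inj_map_eq_map strict_mono_imp_inj_on[OF strict_mono_lift])
  with j a show ?thesis by simp
qed

section \<open>Pattern occurrences\<close>

lemma order_isomorphic_length: "order_isomorphic u v \<Longrightarrow> length u = length v"
  by (simp add: order_isomorphic_def)

lemma occurrences_Nil: "\<tau> \<noteq> [] \<Longrightarrow> occurrences \<tau> [] = 0"
  by (simp add: occurrences_def)

lemma occurrences_Cons:
  assumes "\<tau> \<noteq> []"
  shows "occurrences \<tau> (c # w)
    = of_bool (order_isomorphic (take (length \<tau>) (c # w)) \<tau>) + occurrences \<tau> w"
proof -
  define Q where "Q w i \<longleftrightarrow> i + length \<tau> \<le> length w \<and>
    order_isomorphic (take (length \<tau>) (drop i w)) \<tau>" for w i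
  have fin: "finite {i. Q w i}" for w
    by (rule finite_subset[of _ "{..length w}"]) (auto simp: Q_def)
  have S: "Q (c # w) (Suc i) = Q w i" for i
    by (simp add: Q_def)
  have "{i. Q (c # w) i} = {i. i = 0 \<and> Q (c # w) 0} \<union> Suc ` {i. Q w i}"
  proof (rule set_eqI)
    show "i \<in> {i. Q (c # w) i} \<longleftrightarrow> i \<in> {i. i = 0 \<and> Q (c # w) 0} \<union> Suc ` {i. Q w i}" for i
      by (cases i) (auto simp: S)
  qed
  then have "card {i. Q (c # w) i} = card {i::nat. i = 0 \<and> Q (c # w) 0} + card (Suc ` {i. Q w i})"
    using fin by (simp add: card_Un_disjoint disjoint_iff)
  also have "card (Suc ` {i. Q w i}) = card {i. Q w i}"
    by (simp add: card_image)
  also have "card {i::nat. i = 0 \<and> Q (c # w) 0} = of_bool (Q (c # w) 0)"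
    by (cases "Q (c # w) 0") auto
  \<comment> \<open>A window cut short by the end of the word is already rejected by the length
    clause of \<open>order_isomorphic\<close>.\<close>
  also have "Q (c # w) 0 \<longleftrightarrow> order_isomorphic (take (length \<tau>) (c # w)) \<tau>"
    unfolding Q_def by (auto dest: order_isomorphic_length)
  finally show ?thesis
    by (simp only: occurrences_def Q_def)
qed

lemma order_isomorphic_map:
  assumes "strict_mono (f :: nat \<Rightarrow> nat)"
  shows "order_isomorphic (map f u) v \<longleftrightarrow> order_isomorphic u v"
  using assms by (auto simp: order_isomorphic_def strict_mono_less strict_mono_eq)

lemma occurrences_map:
  assumes "strict_mono f"
  shows "occurrences \<tau> (map f w) = occurrences \<tau> w"
  by (simp add: occurrences_def take_map drop_map order_isomorphic_map[OF assms])

lemma order_isomorphic_sorted: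
  assumes "order_isomorphic u v" "sorted v"
  shows "sorted u"
  using assms unfolding order_isomorphic_def sorted_iff_nth_mono
  by (metis leD leI order_le_less_trans)

text \<open>A window across the boundary contains a strict descent and cannot match a weakly
  increasing pattern. Both patterns of interest are of this kind.\<close>

lemma occurrences_append_descent:
  assumes \<tau>: "\<tau> \<noteq> []" "sorted \<tau>" and v: "v = [] \<or> last u > hd v"
  shows "u \<noteq> [] \<Longrightarrow> occurrences \<tau> (u @ v) = occurrences \<tau> u + occurrences \<tau> v"
  using v
proof (induction u)
  case (Cons c u)
  have "order_isomorphic (take (length \<tau>) ((c # u) @ v)) \<tau>
      \<longleftrightarrow> order_isomorphic (take (length \<tau>) (c # u)) \<tau>"
  proof (cases "length \<tau> \<le> length (c # u) \<or> v = []")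
    case False
    then obtain m where m: "length \<tau> - length (c # u) = Suc m"
      by (metis Suc_diff_Suc not_le)
    obtain y v' where v': "v = y # v'" using False by (cases v) auto
    have "length \<tau> = length (c # u) + Suc m"
      using m by simp
    then have "take (length \<tau>) ((c # u) @ v) = (c # u) @ y # take m v'"
      using v' by simp
    moreover have "\<not> sorted ((c # u) @ y # take m v')"
    proof
      assume "sorted ((c # u) @ y # take m v')"
      then have "last (c # u) \<le> y"
        unfolding sorted_append using last_in_set[of "c # u"]
        by (metis list.distinct(1) list.set_intros(1))
      then show False
        using Cons.prems v' by simp
    qed
    moreover have "\<not> order_isomorphic (take (length \<tau>) (c # u)) \<tau>"
      using False by (auto dest: order_isomorphic_length)
    ultimately show ?thesis
      using order_isomorphic_sorted \<tau>(2) by metis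
  next
    case True
    then show ?thesis by (auto simp del: append_Cons)
  qed
  then show ?case
    using Cons by (cases "u = []") (auto simp: occurrences_Cons \<tau> occurrences_Nil)
qed simp

lemma order_isomorphic_replicate:
  "order_isomorphic u (replicate a c) \<longleftrightarrow> length u = a \<and> (\<forall>x\<in>set u. \<forall>y\<in>set u. x = y)"
proof -
  have "(\<forall>x\<in>set u. \<forall>y\<in>set u. x = y) \<longleftrightarrow> (\<forall>i<length u. \<forall>j<length u. u ! i = u ! j)"
    by (metis in_set_conv_nth)
  moreover have "order_isomorphic u (replicate a c)
      \<longleftrightarrow> length u = a \<and> (\<forall>i<length u. \<forall>j<length u. \<not> u ! i < u ! j \<and> u ! i = u ! j)"
    unfolding order_isomorphic_def by (intro conj_cong) simp_all
  ultimately show ?thesis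
    by (metis less_irrefl)
qed

text \<open>No matching window leaves the run, since the next letter differs. Truncated subtraction
  gives 0 for \<open>j < a\<close>.\<close>

lemma occurrences_run:
  assumes a: "1 \<le> a" and v: "v = [] \<or> hd v \<noteq> c"
  shows "occurrences (replicate a 1) (replicate j c @ v)
    = (j + 1 - a) + occurrences (replicate a 1) v"
proof (induction j)
  case (Suc j)
  have "order_isomorphic (take a (replicate (Suc j) c @ v)) (replicate a 1) \<longleftrightarrow> a \<le> Suc j"
  proof (cases "a \<le> Suc j")
    case False
    then obtain m where m: "a = Suc j + Suc m"
      by (metis add_Suc_right less_imp_Suc_add not_le)
    show ?thesis
      unfolding order_isomorphic_replicate using v m by (cases v) auto
  next
    case True
    then show ?thesis
      unfolding order_isomorphic_replicate by (simp del: replicate_Suc)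
  qed
  then show ?case
    using Suc a by (auto simp: occurrences_Cons)
qed (use a in auto)

lemma order_isomorphic_rise:
  assumes b: "1 \<le> b"
  shows "order_isomorphic u (replicate b 1 @ [2]) \<longleftrightarrow> (\<exists>c d. u = replicate b c @ [d] \<and> c < d)"
proof
  assume iso: "order_isomorphic u (replicate b 1 @ [2])"
  then have len: "length u = Suc b"
    by (simp add: order_isomorphic_def)
  have nth: "u ! i = u ! 0" if "i < b" for i
    using iso that b len unfolding order_isomorphic_def by (auto simp: nth_append)
  have "u ! 0 < u ! b"
    using iso b len unfolding order_isomorphic_def by (auto simp: nth_append)
  moreover have "u = replicate b (u ! 0) @ [u ! b]"
  proof (intro nth_equalityI)
    fix i assume "i < length u"
    then show "u ! i = (replicate b (u ! 0) @ [u ! b]) ! i"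
      using nth[of i] len by (cases "i < b") (simp_all add: nth_append less_Suc_eq)
  qed (simp add: len)
  ultimately show "\<exists>c d. u = replicate b c @ [d] \<and> c < d" by blast
next
  assume "\<exists>c d. u = replicate b c @ [d] \<and> c < d"
  moreover have "(replicate b c @ [d]) ! i = (if i < b then c else d)" if "i < Suc b" for c d :: nat and i
    using that by (auto simp: nth_append less_Suc_eq)
  ultimately show "order_isomorphic u (replicate b 1 @ [2])"
    unfolding order_isomorphic_def by (auto split: if_splits)
qed

text \<open>Any match starting in the run must end at the head of \<open>v\<close>, so it starts
  exactly \<open>b\<close> letters before the end of the run.\<close>

lemma occurrences_rise:
  assumes b: "1 \<le> b" and v: "v = [] \<or> hd v \<noteq> c"
  shows "occurrences (replicate b 1 @ [2]) (replicate j c @ v)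
    = of_bool (b \<le> j \<and> v \<noteq> [] \<and> c < hd v) + occurrences (replicate b 1 @ [2]) v"
proof (induction j)
  case 0
  then show ?case using b by simp
next
  case (Suc j)
  have "order_isomorphic (take (Suc b) (replicate (Suc j) c @ v)) (replicate b 1 @ [2])
      \<longleftrightarrow> b = Suc j \<and> v \<noteq> [] \<and> c < hd v" (is "?L \<longleftrightarrow> ?R")
  proof
    assume ?L
    then obtain e d where ed: "take (Suc b) (replicate (Suc j) c @ v) = replicate b e @ [d]" "e < d"
      unfolding order_isomorphic_rise[OF b] by blast
    have nth: "(replicate (Suc j) c @ v) ! i = (replicate b e @ [d]) ! i" if "i \<le> b" for i
      using arg_cong[OF ed(1), of "\<lambda>u. u ! i"] that
      by (simp del: take_append replicate_Suc)
    have len: "b \<le> j + length v"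
      using arg_cong[OF ed(1), of length] by simp
    have e: "e = c"
      using nth[of 0] b by (simp add: nth_append)
    have d: "(replicate (Suc j) c @ v) ! b = d"
      using nth[of b] by (simp add: nth_append)
    consider "b < Suc j" | "b = Suc j" | "Suc j < b" by linarith
    then show ?R
    proof cases
      case 1
      then show ?thesis using d e ed(2) by (simp add: nth_append del: replicate_Suc)
    next
      case 2
      then show ?thesis using d e ed(2) len by (cases v) (auto simp: nth_append)
    next
      \<comment> \<open>The window would have to repeat \<open>c\<close> beyond the run, against the
        choice of \<open>hd v\<close>; \<open>len\<close> ensures that \<open>v\<close> is not
        empty.\<close>
      case 3
      then have "(replicate (Suc j) c @ v) ! Suc j = c"
        using nth[of "Suc j"] e by (simp add: nth_append)
      then show ?thesis
        using v 3 len by (cases v) (auto simp: nth_append)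
    qed
  next
    assume ?R
    then have "take (Suc b) (replicate (Suc j) c @ v) = replicate b c @ [hd v]"
      by (cases v) auto
    with \<open>?R\<close> show ?L
      unfolding order_isomorphic_rise[OF b] by auto
  qed
  then show ?case
    using Suc by (auto simp: occurrences_Cons)
qed

text \<open>The first factor ends in a letter of at least 2 and the second is empty or starts with
  1, so a descent separates them.\<close>

lemma occurrences_comb_tail:
  assumes \<tau>: "\<tau> \<noteq> []" "sorted \<tau>" and \<alpha>: "\<alpha> \<in> ncw" "\<alpha> \<noteq> []" and \<rho>: "\<rho> \<in> ncw"
  shows "occurrences \<tau> (map Suc \<alpha> @ map (lift k) \<rho>) = occurrences \<tau> \<alpha> + occurrences \<tau> \<rho>"
proof -
  have "0 < last \<alpha>"
    using \<alpha> rgf_pos[of \<alpha> "last \<alpha>"] by (simp add: ncw_def)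
  moreover have "\<rho> = [] \<or> hd \<rho> = 1"
    using \<rho> rgf_Cons by (cases \<rho>) (auto simp: ncw_def)
  ultimately have "map (lift k) \<rho> = [] \<or> last (map Suc \<alpha>) > hd (map (lift k) \<rho>)"
    using \<alpha>(2) by (cases \<rho>) (auto simp: last_map lift_def)
  then show ?thesis
    using \<alpha>(2) occurrences_append_descent[OF \<tau>]
    by (simp add: occurrences_map strict_mono_Suc strict_mono_lift)
qed

section \<open>Weights of runs and of factored words\<close>

definition weight :: "nat \<Rightarrow> nat \<Rightarrow> nat list \<Rightarrow> int poly poly" where
  "weight a b w =
     var_p ^ occurrences (replicate a 1) w * var_q ^ occurrences (replicate b 1 @ [2]) w"

lemma weight_Nil: "1 \<le> a \<Longrightarrow> weight a b [] = 1"
  by (simp add: weight_def occurrences_Nil)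

lemma weight_replicate:
  assumes "1 \<le> a" "1 \<le> b"
  shows "weight a b (replicate j 1) = var_p ^ (j + 1 - a)"
  using occurrences_run[OF assms(1), of "[]" 1 j] occurrences_rise[OF assms(2), of "[]" 1 j] assms(1)
  by (simp add: weight_def occurrences_Nil)

text \<open>The extra \<open>var_q\<close> is the copy of the rise pattern that ends at the first
  letter of the shifted \<open>\<alpha>\<close>.\<close>

lemma weight_comb:
  assumes ab: "1 \<le> a" "1 \<le> b" and \<alpha>: "\<alpha> \<in> ncw" "\<alpha> \<noteq> []" and \<rho>: "\<rho> \<in> ncw"
  shows "weight a b (comb j \<alpha> \<rho>)
    = var_p ^ (j + 1 - a) * (if b \<le> j then var_q else 1) * (weight a b \<alpha> * weight a b \<rho>)"
proof -
  let ?v = "map Suc \<alpha> @ map (lift (card (set \<alpha>))) \<rho>"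
  have "0 < hd \<alpha>"
    using \<alpha> rgf_pos[of \<alpha> "hd \<alpha>"] by (simp add: ncw_def)
  then have v: "?v \<noteq> []" "1 < hd ?v"
    using \<alpha>(2) by (auto simp: hd_map)
  then have v': "?v = [] \<or> hd ?v \<noteq> 1" by auto
  have "occurrences (replicate a 1) (comb j \<alpha> \<rho>) = (j + 1 - a)
      + (occurrences (replicate a 1) \<alpha> + occurrences (replicate a 1) \<rho>)"
    unfolding comb_def occurrences_run[OF ab(1) v']
    using ab(1) by (subst occurrences_comb_tail) (auto simp: \<alpha> \<rho>)
  moreover have "occurrences (replicate b 1 @ [2]) (comb j \<alpha> \<rho>) = of_bool (b \<le> j)
      + (occurrences (replicate b 1 @ [2]) \<alpha> + occurrences (replicate b 1 @ [2]) \<rho>)"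
    unfolding comb_def occurrences_rise[OF ab(2) v']
    using v by (subst occurrences_comb_tail) (auto simp: \<alpha> \<rho> sorted_append)
  ultimately show ?thesis
    by (simp add: weight_def power_add algebra_simps)
qed

section \<open>Generating functions of weighted sets\<close>

unbundle fps_syntax

text \<open>A sum over an infinite level would default to 0, so finiteness of levels is assumed
  wherever classes are united or multiplied.\<close>

definition gf :: "('a \<Rightarrow> nat) \<Rightarrow> ('a \<Rightarrow> 'r::comm_ring_1) \<Rightarrow> 'a set \<Rightarrow> 'r fps" where
  "gf sz wt A = Abs_fps (\<lambda>n. \<Sum>x | x \<in> A \<and> sz x = n. wt x)"

lemma gf_cong:
  assumes "\<And>x. x \<in> A \<Longrightarrow> sz x = sz' x" "\<And>x. x \<in> A \<Longrightarrow> wt x = wt' x"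
  shows "gf sz wt A = gf sz' wt' A"
  unfolding gf_def using assms by (intro arg_cong[of _ _ Abs_fps] ext sum.cong) auto

lemma gf_Un_disjoint:
  assumes "\<And>n. finite {x \<in> A. sz x = n}" "\<And>n. finite {x \<in> B. sz x = n}" "A \<inter> B = {}"
  shows "gf sz wt (A \<union> B) = gf sz wt A + gf sz wt B"
proof (rule fps_ext)
  fix n
  have "{x. x \<in> A \<union> B \<and> sz x = n} = {x \<in> A. sz x = n} \<union> {x \<in> B. sz x = n}"
    by auto
  then show "gf sz wt (A \<union> B) $ n = (gf sz wt A + gf sz wt B) $ n"
    unfolding gf_def using assms by (simp add: sum.union_disjoint disjoint_iff)
qed

lemma gf_image:
  assumes "inj_on h A"
  shows "gf sz wt (h ` A) = gf (\<lambda>x. sz (h x)) (\<lambda>x. wt (h x)) A"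
proof (rule fps_ext)
  fix n
  have "{y. y \<in> h ` A \<and> sz y = n} = h ` {x. x \<in> A \<and> sz (h x) = n}"
    by auto
  moreover have "inj_on h {x. x \<in> A \<and> sz (h x) = n}"
    using assms by (rule inj_on_subset) auto
  ultimately show "gf sz wt (h ` A) $ n = gf (\<lambda>x. sz (h x)) (\<lambda>x. wt (h x)) A $ n"
    unfolding gf_def by (simp add: sum.reindex)
qed

text \<open>Level \<open>n\<close> of the product is a disjoint union of rectangles of levels
  \<open>i\<close> and \<open>n - i\<close>, matching the Cauchy product.\<close>

lemma gf_Times:
  assumes A: "\<And>n. finite {x \<in> A. sz x = n}" and B: "\<And>n. finite {x \<in> B. sz' x = n}"
  shows "gf (\<lambda>(x, y). sz x + sz' y) (\<lambda>(x, y). wt x * wt' y) (A \<times> B)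
    = gf sz wt A * gf sz' wt' B"
proof (rule fps_ext)
  fix n
  let ?A = "\<lambda>i. {x \<in> A. sz x = i}" and ?B = "\<lambda>i. {x \<in> B. sz' x = i}"
  have "{z. z \<in> A \<times> B \<and> (case z of (x, y) \<Rightarrow> sz x + sz' y) = n} = (\<Union>i\<in>{0..n}. ?A i \<times> ?B (n - i))"
    by auto
  then have "gf (\<lambda>(x, y). sz x + sz' y) (\<lambda>(x, y). wt x * wt' y) (A \<times> B) $ n
      = (\<Sum>(x, y)\<in>(\<Union>i\<in>{0..n}. ?A i \<times> ?B (n - i)). wt x * wt' y)"
    unfolding gf_def by simp
  also have "\<dots> = (\<Sum>i=0..n. \<Sum>(x, y)\<in>?A i \<times> ?B (n - i). wt x * wt' y)"
    using A B by (subst sum.UNION_disjoint) auto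
  also have "\<dots> = (gf sz wt A * gf sz' wt' B) $ n"
    unfolding gf_def fps_mult_nth by (simp add: sum.cartesian_product[symmetric] sum_product)
  finally show "gf (\<lambda>(x, y). sz x + sz' y) (\<lambda>(x, y). wt x * wt' y) (A \<times> B) $ n
      = (gf sz wt A * gf sz' wt' B) $ n" .
qed

lemma finite_level_Times:
  assumes A: "\<And>n. finite {x \<in> A. sz x = n}" and B: "\<And>n. finite {x \<in> B. sz' x = n}"
  shows "finite {z \<in> A \<times> B. (case z of (x, y) \<Rightarrow> sz x + sz' y) = (n::nat)}"
proof (rule finite_subset)
  show "{z \<in> A \<times> B. (case z of (x, y) \<Rightarrow> sz x + sz' y) = n}
      \<subseteq> (\<Union>i\<in>{0..n}. {x \<in> A. sz x = i} \<times> {x \<in> B. sz' x = n - i})"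
    by auto
qed (use A B in auto)

lemma gf_positive: "gf (\<lambda>j. j) f {0<..} = Abs_fps (\<lambda>n. if n = 0 then 0 else f n)"
proof (rule fps_ext)
  fix n :: nat
  have "{j. j \<in> {0<..} \<and> j = n} = (if n = 0 then {} else {n})"
    by auto
  then show "gf (\<lambda>j. j) f {0<..} $ n = Abs_fps (\<lambda>n. if n = 0 then 0 else f n) $ n"
    unfolding gf_def by simp
qed

section \<open>The functional equation of the series\<close>

lemma NC_gf_eq: "NC_gf a b = gf length (weight a b) ncw"
  unfolding NC_gf_def gf_def weight_def NC_eq by simp

text \<open>The series of non-empty runs of ones, by length.\<close>

definition run_gf :: "nat \<Rightarrow> int poly poly fps" where
  "run_gf a = Abs_fps (\<lambda>j. if j = 0 then 0 else var_p ^ (j + 1 - a))"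

text \<open>Runs long enough to complete a rise pattern; adding \<open>q - 1\<close> times this
  series turns their factor 1 into \<open>q\<close>.\<close>

definition long_run_gf :: "nat \<Rightarrow> nat \<Rightarrow> int poly poly fps" where
  "long_run_gf a b = Abs_fps (\<lambda>j. if j < b then 0 else var_p ^ (j + 1 - a))"

text \<open>Non-empty words are either runs or images of triples under \<open>comb\<close>; the
  factor \<open>F - 1\<close> reflects that \<open>\<alpha>\<close> is non-empty.\<close>

lemma NC_gf_recurrence:
  assumes ab: "1 \<le> a" "1 \<le> b"
  defines "F \<equiv> NC_gf a b"
  shows "F = 1 + run_gf a
    + (run_gf a + (fps_const var_q - 1) * long_run_gf a b) * ((F - 1) * F)"
proof -
  let ?w = "weight a b"
  define ne where "ne = ncw - {[]}"
  define R where "R = (\<lambda>j. replicate j (1::nat)) ` {0<..}"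
  define C where "C = (\<lambda>(j, \<alpha>, \<rho>). comb j \<alpha> \<rho>) ` ({0<..} \<times> ne \<times> ncw)"
  have sub: "R \<subseteq> ne" "C \<subseteq> ne" "ne \<subseteq> ncw"
    using replicate_in_ncw comb_in_ncw by (auto simp: R_def C_def ne_def comb_def)
  have fin: "finite {w \<in> A. length w = n}" if "A \<subseteq> ncw" for A n
    by (rule finite_subset[OF _ ncw_finite[of n]]) (use that in auto)
  have ne: "ne = R \<union> C"
  proof
    show "ne \<subseteq> R \<union> C"
    proof
      fix w assume "w \<in> ne"
      then have "w \<in> ncw" "w \<noteq> []" by (auto simp: ne_def)
      from ncw_cases[OF this] consider j where "0 < j" "w = replicate j 1"
        | j \<alpha> \<rho> where "0 < j" "\<alpha> \<in> ne" "\<rho> \<in> ncw" "w = comb j \<alpha> \<rho>"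
        unfolding ne_def by blast
      then show "w \<in> R \<union> C"
      proof cases
        case 1
        then show ?thesis by (simp add: R_def)
      next
        case 2
        then have "w \<in> C"
          unfolding C_def by (intro image_eqI[of _ _ "(j, \<alpha>, \<rho>)"]) simp_all
        then show ?thesis by simp
      qed
    qed
  qed (use sub in auto)
  \<comment> \<open>The shifted first letter of \<open>\<alpha>\<close> is at least 2 and so cannot
    occur in a run.\<close>
  have disj: "R \<inter> C = {}"
  proof -
    have "replicate i 1 \<noteq> comb j \<alpha> \<rho>" if "\<alpha> \<in> ne" for i j \<alpha> \<rho>
    proof
      assume eq: "replicate i 1 = comb j \<alpha> \<rho>"
      have "\<alpha> \<noteq> []" "rgf \<alpha>" using that by (auto simp: ne_def ncw_def)
      then have "0 < hd \<alpha>" using rgf_pos by simp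
      have "Suc (hd \<alpha>) \<in> set (comb j \<alpha> \<rho>)"
        using \<open>\<alpha> \<noteq> []\<close> by (simp add: comb_def)
      with \<open>0 < hd \<alpha>\<close> show False by (simp flip: eq)
    qed
    then show ?thesis by (auto simp: R_def C_def)
  qed
  have F1: "gf length ?w ne = F - 1"
  proof -
    have "F = gf length ?w ({[]} \<union> ne)"
      using replicate_in_ncw[of 0] by (simp add: F_def NC_gf_eq ne_def insert_absorb)
    also have "\<dots> = gf length ?w {[]} + gf length ?w ne"
      by (rule gf_Un_disjoint) (use fin[OF sub(3)] in \<open>auto simp: ne_def\<close>)
    also have "gf length ?w {[]} = 1"
    proof (rule fps_ext)
      fix n
      have "{x. x \<in> {[]} \<and> length x = n} = (if n = 0 then {[]} else {})" by auto
      then show "gf length ?w {[]} $ n = 1 $ n"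
        using ab by (simp add: gf_def weight_Nil)
    qed
    finally show ?thesis by simp
  qed
  have inj_R: "inj_on (\<lambda>j. replicate j (1::nat)) {0<..}"
    by (auto intro!: inj_onI)
  have R: "gf length ?w R = run_gf a"
    unfolding R_def gf_image[OF inj_R] weight_replicate[OF ab] length_replicate gf_positive run_gf_def ..
  define f where "f j = var_p ^ (j + 1 - a) * (if b \<le> j then var_q else 1)" for j
  have inj: "inj_on (\<lambda>(j, \<alpha>, \<rho>). comb j \<alpha> \<rho>) ({0<..} \<times> ne \<times> ncw)"
  proof (rule inj_onI)
    fix y z
    assume "y \<in> {0<..} \<times> ne \<times> ncw" "z \<in> {0<..} \<times> ne \<times> ncw"
      and eq: "(\<lambda>(j, \<alpha>, \<rho>). comb j \<alpha> \<rho>) y = (\<lambda>(j, \<alpha>, \<rho>). comb j \<alpha> \<rho>) z"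
    moreover obtain j \<alpha> \<rho> where "y = (j, \<alpha>, \<rho>)" by (cases y)
    moreover obtain j' \<alpha>' \<rho>' where "z = (j', \<alpha>', \<rho>')" by (cases z)
    ultimately show "y = z"
      using comb_inj[of \<alpha> \<alpha>' \<rho> \<rho>' j j'] by (simp add: ne_def)
  qed
  have "?w (comb j \<alpha> \<rho>) = f j * (?w \<alpha> * ?w \<rho>)" if "\<alpha> \<in> ne" "\<rho> \<in> ncw" for j \<alpha> \<rho>
    using weight_comb[OF ab, of \<alpha> \<rho> j] that by (simp add: ne_def f_def)
  then have "gf length ?w C = gf (\<lambda>(j, z). j + (case z of (\<alpha>, \<rho>) \<Rightarrow> length \<alpha> + length \<rho>))
      (\<lambda>(j, z). f j * (case z of (\<alpha>, \<rho>) \<Rightarrow> ?w \<alpha> * ?w \<rho>)) ({0<..} \<times> ne \<times> ncw)"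
    unfolding C_def gf_image[OF inj]
    by (intro gf_cong) (auto simp: length_comb)
  \<comment> \<open>Triples are nested pairs, so the product rule applies twice.\<close>
  also have "\<dots> = gf (\<lambda>j. j) f {0<..} * (gf length ?w ne * gf length ?w ncw)"
    using finite_level_Times[OF fin[OF sub(3)] fin[OF order_refl]]
    by (subst gf_Times) (auto simp: gf_Times fin sub)
  also have "gf (\<lambda>j. j) f {0<..} = run_gf a + (fps_const var_q - 1) * long_run_gf a b"
  proof (rule fps_ext)
    fix n
    have "(fps_const var_q - 1 :: int poly poly fps) = fps_const (var_q - 1)"
      by (simp flip: fps_const_sub)
    then show "gf (\<lambda>j. j) f {0<..} $ n = (run_gf a + (fps_const var_q - 1) * long_run_gf a b) $ n"
      using ab by (simp add: gf_positive f_def run_gf_def long_run_gf_def algebra_simps)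
  qed
  finally have C: "gf length ?w C
      = (run_gf a + (fps_const var_q - 1) * long_run_gf a b) * ((F - 1) * F)"
    by (simp add: F1 F_def NC_gf_eq)
  have "F = 1 + (F - 1)" by simp
  also have "F - 1 = gf length ?w R + gf length ?w C"
    unfolding F1[symmetric] ne using sub fin disj by (intro gf_Un_disjoint) auto
  finally show ?thesis
    unfolding R C add.assoc .
qed

section \<open>Closed forms of the run series\<close>

lemma geometric_series: "(1 - fps_const (c::'r::comm_ring_1) * fps_X) * Abs_fps (\<lambda>n. c ^ n) = 1"
proof (rule fps_ext)
  fix n
  show "((1 - fps_const c * fps_X) * Abs_fps (\<lambda>n. c ^ n)) $ n = 1 $ n"
    by (cases n) (simp_all add: algebra_simps mult.assoc)
qed

text \<open>The coefficients are 1 below exponent \<open>a\<close> and then geometric with ratio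
  \<open>p\<close>, so the product of both geometric denominators clears every series. A start
  beyond \<open>a\<close> leaves only the second regime.\<close>

lemma run_series_closed_forms:
  fixes p x :: "int poly poly fps"
  defines "p \<equiv> fps_const var_p" and "x \<equiv> fps_X"
  assumes a: "1 \<le> a" and b: "1 \<le> b"
  shows "(1 - x) * (1 - p * x) * run_gf a = x - p * x^2 + (p - 1) * x^a"
    and "b \<le> a \<Longrightarrow> (1 - x) * (1 - p * x) * long_run_gf a b = (1 - p * x) * x^b + (p - 1) * x^a"
    and "a < b \<Longrightarrow> (1 - x) * (1 - p * x) * long_run_gf a b = (1 - x) * p^(b - a + 1) * x^b"
proof -
  define G where "G = Abs_fps (\<lambda>n. var_p ^ n)"
  define H :: "int poly poly fps" where "H = Abs_fps (\<lambda>n. 1 ^ n)"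
  have G: "(1 - p * x) * G = 1"
    unfolding G_def p_def x_def by (rule geometric_series)
  have H: "(1 - x) * H = 1"
    using geometric_series[of "1 :: int poly poly"]
    unfolding H_def x_def fps_const_1_eq_1 mult_1_left .
  have collapse: "(1 - x) * (1 - p * x) * (x^i * H - x^a * H + p * x^a * G)
      = (1 - p * x) * x^i + (p - 1) * x^a" for i
  proof -
    have "(1 - x) * (1 - p * x) * (x^i * H - x^a * H + p * x^a * G)
      = (1 - p * x) * (x^i - x^a) * ((1 - x) * H) + p * x^a * (1 - x) * ((1 - p * x) * G)"
      by (simp add: algebra_simps)
    also have "\<dots> = (1 - p * x) * x^i + (p - 1) * x^a"
      unfolding G H by (simp add: algebra_simps)
    finally show ?thesis .
  qed
  \<comment> \<open>The difference of the \<open>H\<close> terms is the block of ones from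
    \<open>i\<close> to \<open>a - 1\<close>; the \<open>G\<close> term starts at \<open>a\<close>
    with coefficient \<open>p\<close>.\<close>
  have long: "long_run_gf a i = x^i * H - x^a * H + p * x^a * G" if "i \<le> a" for i
  proof (rule fps_ext)
    fix n
    have "(p * x^a * G) $ n = var_p * (x^a * G) $ n"
      by (simp only: p_def mult.assoc fps_mult_left_const_nth)
    also have "\<dots> = (if n < a then 0 else var_p * var_p ^ (n - a))"
      by (simp add: x_def G_def fps_X_power_mult_nth)
    finally have "(p * x^a * G) $ n = (if n < a then 0 else var_p * var_p ^ (n - a))" .
    moreover have "var_p * var_p ^ (n - a) = var_p ^ (n + 1 - a)" if "a \<le> n"
      using that by (simp add: Suc_diff_le)
    ultimately show "long_run_gf a i $ n = (x^i * H - x^a * H + p * x^a * G) $ n"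
      using that by (simp add: long_run_gf_def x_def H_def fps_X_power_mult_nth)
  qed
  have "run_gf a = long_run_gf a 1"
    by (simp add: run_gf_def long_run_gf_def)
  then have "(1 - x) * (1 - p * x) * run_gf a = (1 - p * x) * x^1 + (p - 1) * x^a"
    by (simp only: long[OF a] collapse)
  then show "(1 - x) * (1 - p * x) * run_gf a = x - p * x^2 + (p - 1) * x^a"
    by (simp add: algebra_simps power2_eq_square)
  show "(1 - x) * (1 - p * x) * long_run_gf a b = (1 - p * x) * x^b + (p - 1) * x^a" if "b \<le> a"
    using long[OF that] collapse[of b] by simp
  show "(1 - x) * (1 - p * x) * long_run_gf a b = (1 - x) * p^(b - a + 1) * x^b" if "a < b"
  proof -
    have "long_run_gf a b = p^(b - a + 1) * (x^b * G)"
    proof (rule fps_ext)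
      fix n
      have "n + 1 - a = (b - a + 1) + (n - b)" if "b \<le> n"
        using that \<open>a < b\<close> by simp
      then show "long_run_gf a b $ n = (p^(b - a + 1) * (x^b * G)) $ n"
        by (simp add: long_run_gf_def p_def x_def G_def fps_X_power_mult_nth fps_const_power
            power_add[symmetric] del: power_Suc)
    qed
    then have "(1 - x) * (1 - p * x) * long_run_gf a b
        = (1 - x) * p^(b - a + 1) * x^b * ((1 - p * x) * G)"
      by (simp only: mult_ac)
    then show ?thesis by (simp add: G)
  qed
qed

theorem theorem1:
  fixes a b :: nat and F p q x :: "int poly poly fps"
  assumes "a \<ge> 1" and "b \<ge> 1"
    and F: "F = NC_gf a b"
    and p: "p = fps_const var_p"
    and q: "q = fps_const var_q"
    and x: "x = fps_X"
  shows "(a \<ge> b \<longrightarrow>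
      (x - p * x^2 + q * (p - 1) * x^a + (q - 1) * (1 - p * x) * x^b) * F^2
      = (1 - p * x + q * (p - 1) * x^a + (q - 1) * (1 - p * x) * x^b) * F
        - 1 + p * x - (p - 1) * x^a)
    \<and> (a < b \<longrightarrow>
      (x - p * x^2 + (p - 1) * x^a + (q - 1) * (1 - x) * p^(b - a + 1) * x^b) * F^2
      = (1 - p * x + (p - 1) * x^a + (q - 1) * (1 - x) * p^(b - a + 1) * x^b) * F
        - 1 + p * x - (p - 1) * x^a)"
proof -
  define U V D where "U = run_gf a" and "V = long_run_gf a b" and "D = (1 - x) * (1 - p * x)"
  have rec: "F = 1 + U + (U + (q - 1) * V) * ((F - 1) * F)"
    unfolding F U_def V_def q by (rule NC_gf_recurrence[OF assms(1,2)])
  have DU: "D * U = x - p * x^2 + (p - 1) * x^a"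
    unfolding D_def U_def p x by (rule run_series_closed_forms(1)[OF assms(1,2)])
  have D: "D = 1 - x - p * x + p * x^2"
    by (simp add: D_def algebra_simps power2_eq_square)
  \<comment> \<open>\<open>D\<close> is a common denominator of \<open>U\<close> and
    \<open>V\<close>, so only the polynomials \<open>D * U\<close> and \<open>D * V\<close>
    remain.\<close>
  have "D * F = D + D * U + (D * U + (q - 1) * (D * V)) * ((F - 1) * F)"
    using arg_cong[OF rec, of "\<lambda>t. D * t"] by (simp add: algebra_simps)
  then have main: "(D * U + (q - 1) * (D * V)) * F^2
      = (D + D * U + (q - 1) * (D * V)) * F - D - D * U"
    by (simp add: algebra_simps power2_eq_square)
  show ?thesis
  proof (intro conjI impI)
    assume "b \<le> a"
    then have DV: "D * V = (1 - p * x) * x^b + (p - 1) * x^a"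
      unfolding D_def V_def p x by (rule run_series_closed_forms(2)[OF assms(1,2)])
    show "(x - p * x^2 + q * (p - 1) * x^a + (q - 1) * (1 - p * x) * x^b) * F^2
      = (1 - p * x + q * (p - 1) * x^a + (q - 1) * (1 - p * x) * x^b) * F
        - 1 + p * x - (p - 1) * x^a"
      \<comment> \<open>Here \<open>D + D * U\<close> reduces to
        \<open>1 - p * x + (p - 1) * x^a\<close>, and the two multiples of
        \<open>(p - 1) * x^a\<close> in the coefficient of \<open>F^2\<close> merge into
        \<open>q * (p - 1) * x^a\<close>.\<close>
      using main unfolding DU DV unfolding D by (simp add: algebra_simps)
  next
    assume "a < b"
    then have DV: "D * V = (1 - x) * p^(b - a + 1) * x^b"
      unfolding D_def V_def p x by (rule run_series_closed_forms(3)[OF assms(1,2)])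
    show "(x - p * x^2 + (p - 1) * x^a + (q - 1) * (1 - x) * p^(b - a + 1) * x^b) * F^2
      = (1 - p * x + (p - 1) * x^a + (q - 1) * (1 - x) * p^(b - a + 1) * x^b) * F
        - 1 + p * x - (p - 1) * x^a"
      using main unfolding DU DV unfolding D by (simp add: algebra_simps del: power_Suc)
  qed
qed

end
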